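(* Let $X$ be a finite set. For any $\ast\in\mathcal{M}(X)$, the principal right ideal generated by $\ast$ is $$\ast\mathcal{M}(X)=\{\diamond\in\mathcal{M}(X):\pi_\diamond\supseteq\pi_\ast\}.$$
   Context: $\mathcal{M}(X)=X^{X\times X}$ is the set of all binary operations on $X$, a monoid under $\triangleright$ defined by $a(\circ\triangleright\ast)b=(a\circ b)\ast(b\circ a)$ for all $a,b\in X$, with identity $a\circ_{lz}b=a$. The principal right ideal generated by $\ast$ is $\ast\mathcal{M}(X)=\{\ast\triangleright\circ:\circ\in\mathcal{M}(X)\}$. For $\ast\in\mathcal{M}(X)$ let $T_\ast:X\times X\to X\times X$, $T_\ast(a,b)=(a\ast b,b\ast a)$, and let $\pi_\ast$ be the equivalence relation on $X\times X$ defined by $(a,b)\,\pi_\ast\,(u,v)\iff T_\ast(a,b)=T_\ast(u,v)$. Inclusion of relations is as subsets of $(X\times X)\times(X\times X)$. *)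

theory Defs
  imports "HOL-Library.FuncSet" "HOL-Algebra.Group"
begin

text \<open>
  A binary operation on the set \<open>X\<close> is an element of \<open>X \<times> X \<rightarrow>\<^sub>E X\<close>. Extensionality (the value
  \<open>undefined\<close> outside \<open>X \<times> X\<close>) makes equality of operations coincide with equality on
  \<open>X \<times> X\<close>, so that \<open>X\<^bsup>X \<times> X\<^esup>\<close> is represented without repetitions.
  The operations form a monoid under \<open>a (c \<triangleright> s) b = (a c b) s (b c a)\<close>.
\<close>

definition binop_monoid :: "'a set \<Rightarrow> ('a \<times> 'a \<Rightarrow> 'a) monoid" where
  "binop_monoid X =
    \<lparr>carrier = X \<times> X \<rightarrow>\<^sub>E X,
     mult = (\<lambda>c s. restrict (\<lambda>(a, b). s (c (a, b), c (b, a))) (X \<times> X)),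
     one = restrict (\<lambda>(a, b). a) (X \<times> X)\<rparr>"

definition principal_right_ideal :: "('m, 'r) monoid_scheme \<Rightarrow> 'm \<Rightarrow> 'm set" where
  "principal_right_ideal G x = {x \<otimes>\<^bsub>G\<^esub> y | y. y \<in> carrier G}"

definition T_map :: "('a \<times> 'a \<Rightarrow> 'a) \<Rightarrow> 'a \<times> 'a \<Rightarrow> 'a \<times> 'a" where
  "T_map s = (\<lambda>(a, b). (s (a, b), s (b, a)))"

definition pi_rel :: "'a set \<Rightarrow> ('a \<times> 'a \<Rightarrow> 'a) \<Rightarrow> (('a \<times> 'a) \<times> ('a \<times> 'a)) set" where
  "pi_rel X s = {(p, q). p \<in> X \<times> X \<and> q \<in> X \<times> X \<and> T_map s p = T_map s q}"

lemma monoid_binop_monoid: "Group.monoid (binop_monoid X)"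
proof (rule monoidI)
  fix c s assume "c \<in> carrier (binop_monoid X)" "s \<in> carrier (binop_monoid X)"
  then show "c \<otimes>\<^bsub>binop_monoid X\<^esub> s \<in> carrier (binop_monoid X)"
    by (auto simp: binop_monoid_def PiE_iff)
next
  show "\<one>\<^bsub>binop_monoid X\<^esub> \<in> carrier (binop_monoid X)"
    by (auto simp: binop_monoid_def)
next
  fix c s t
  assume "c \<in> carrier (binop_monoid X)" "s \<in> carrier (binop_monoid X)"
    "t \<in> carrier (binop_monoid X)"
  then show "c \<otimes>\<^bsub>binop_monoid X\<^esub> s \<otimes>\<^bsub>binop_monoid X\<^esub> t
      = c \<otimes>\<^bsub>binop_monoid X\<^esub> (s \<otimes>\<^bsub>binop_monoid X\<^esub> t)"
    by (auto simp: binop_monoid_def PiE_iff fun_eq_iff restrict_def)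
next
  fix c assume "c \<in> carrier (binop_monoid X)"
  then show "\<one>\<^bsub>binop_monoid X\<^esub> \<otimes>\<^bsub>binop_monoid X\<^esub> c = c"
    by (auto simp: binop_monoid_def PiE_iff fun_eq_iff restrict_def extensional_def)
next
  fix c assume "c \<in> carrier (binop_monoid X)"
  then show "c \<otimes>\<^bsub>binop_monoid X\<^esub> \<one>\<^bsub>binop_monoid X\<^esub> = c"
    by (auto simp: binop_monoid_def PiE_iff fun_eq_iff restrict_def extensional_def)
qed

lemma equiv_pi_rel: "equiv (X \<times> X) (pi_rel X s)"
  by (auto simp: pi_rel_def equiv_def refl_on_def sym_def trans_def)

end

theory Submission
  imports Defs
begin

text \<open>Multiples of \<open>s\<close> are thus exactly the operations that factor through
  \<open>T_map s\<close>, whose kernel on \<open>X \<times> X\<close> is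
  \<open>pi_rel X s\<close>.\<close>

lemma mult_binop_monoid:
  "s \<otimes>\<^bsub>binop_monoid X\<^esub> y = restrict (y \<circ> T_map s) (X \<times> X)"
  by (auto simp: binop_monoid_def T_map_def restrict_def fun_eq_iff)

lemma fst_T_map: "fst (T_map s p) = s p"
  by (simp add: T_map_def split_beta)

lemma T_map_in:
  assumes "s \<in> carrier (binop_monoid X)" "p \<in> X \<times> X"
  shows "T_map s p \<in> X \<times> X"
  using assms by (auto simp: binop_monoid_def T_map_def)

text \<open>Swapping the arguments swaps the components of \<open>T_map s\<close>, so
  \<open>T_map s (a, b)\<close> also determines \<open>T_map s (b, a)\<close>, and with it both
  components of \<open>T_map\<close> of the product.\<close>

lemma pi_rel_subset_mult:
  "pi_rel X s \<subseteq> pi_rel X (s \<otimes>\<^bsub>binop_monoid X\<^esub> y)"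
  by (auto simp: pi_rel_def mult_binop_monoid T_map_def)

text \<open>The factor sends \<open>T_map s p\<close> to \<open>d p\<close>, which is well defined because
  \<open>T_map d p\<close> has first component \<open>d p\<close>; off the range of \<open>T_map s\<close> its values are arbitrary.\<close>
lemma mult_factor_if_pi_rel_subset:
  assumes s: "s \<in> carrier (binop_monoid X)"
    and d: "d \<in> carrier (binop_monoid X)"
    and sub: "pi_rel X s \<subseteq> pi_rel X d"
  obtains y where "y \<in> carrier (binop_monoid X)" "d = s \<otimes>\<^bsub>binop_monoid X\<^esub> y"
proof
  define g where "g = inv_into (X \<times> X) (T_map s)"
  \<comment> \<open>The default \<open>fst q\<close> lies in \<open>X\<close> for each
    \<open>q\<close> in \<open>X \<times> X\<close>, so no element of \<open>X\<close> has to be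
    chosen and empty \<open>X\<close> needs no separate case.\<close>
  define y where
    "y = restrict (\<lambda>q. if q \<in> T_map s ` (X \<times> X) then d (g q) else fst q) (X \<times> X)"
  have d_in: "d p \<in> X" if "p \<in> X \<times> X" for p
    using d that by (auto simp: binop_monoid_def)
  have g_in: "g q \<in> X \<times> X" if "q \<in> T_map s ` (X \<times> X)" for q
    unfolding g_def using that by (rule inv_into_into)
  have fst_in: "fst q \<in> X" if "q \<in> X \<times> X" for q
    using that by auto
  show "y \<in> carrier (binop_monoid X)"
    unfolding y_def binop_monoid_def partial_object.simps restrict_PiE_iff
    by (simp add: d_in g_in fst_in)
  have "y (T_map s p) = d p" if p: "p \<in> X \<times> X" for p
  proof -
    \<comment> \<open>The preimage picked by \<open>g\<close> may differ from \<open>p\<close>, but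
      both have the same image under \<open>T_map s\<close>.\<close>
    have "T_map s (g (T_map s p)) = T_map s p"
      unfolding g_def using p by (intro f_inv_into_f imageI)
    then have "(g (T_map s p), p) \<in> pi_rel X s"
      using p g_in[OF imageI[OF p]] by (simp add: pi_rel_def)
    then have "(g (T_map s p), p) \<in> pi_rel X d"
      using sub by (rule rev_subsetD)
    then have "T_map d (g (T_map s p)) = T_map d p"
      by (simp add: pi_rel_def)
    then have "d (g (T_map s p)) = d p"
      by (metis fst_T_map)
    \<comment> \<open>\<open>T_map_in\<close> keeps \<open>T_map s p\<close> inside
      \<open>X \<times> X\<close>, where the outer \<open>restrict\<close> leaves \<open>y\<close>
      unchanged.\<close>
    then show ?thesis
      using p T_map_in[OF s p] by (simp add: y_def)
  qed
  \<comment> \<open>Both sides are \<open>undefined\<close> off \<open>X \<times> X\<close>, so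
    agreement there gives equality of functions.\<close>
  moreover have "d \<in> extensional (X \<times> X)"
    using d by (auto simp: binop_monoid_def PiE_def)
  ultimately show "d = s \<otimes>\<^bsub>binop_monoid X\<^esub> y"
    unfolding mult_binop_monoid
    by (intro extensionalityI[of _ "X \<times> X"]) (simp_all)
qed

theorem theorem12:
  fixes X :: "'a set" and s :: "'a \<times> 'a \<Rightarrow> 'a"
  assumes "finite X"
    and "s \<in> carrier (binop_monoid X)"
  shows "principal_right_ideal (binop_monoid X) s =
    {d \<in> carrier (binop_monoid X). pi_rel X s \<subseteq> pi_rel X d}"
proof (intro subset_antisym subsetI)
  fix d assume "d \<in> principal_right_ideal (binop_monoid X) s"
  then obtain y where "y \<in> carrier (binop_monoid X)" "d = s \<otimes>\<^bsub>binop_monoid X\<^esub> y"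
    by (auto simp: principal_right_ideal_def)
  then show "d \<in> {d \<in> carrier (binop_monoid X). pi_rel X s \<subseteq> pi_rel X d}"
    using monoid.m_closed[OF monoid_binop_monoid assms(2)] by (simp add: pi_rel_subset_mult)
next
  fix d assume "d \<in> {d \<in> carrier (binop_monoid X). pi_rel X s \<subseteq> pi_rel X d}"
  then obtain y where "y \<in> carrier (binop_monoid X)" "d = s \<otimes>\<^bsub>binop_monoid X\<^esub> y"
    using mult_factor_if_pi_rel_subset[OF assms(2), of d] by auto
  then show "d \<in> principal_right_ideal (binop_monoid X) s"
    by (auto simp: principal_right_ideal_def)
qed

end
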